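(* Every C-eigenvalue of a conjugate partial-symmetric tensor is real, and every G-eigenvalue of a conjugate super-symmetric tensor is real.
   Context: For a tensor $\mathcal{F}\in\mathbb{C}^{N^{m}}$, $\mathcal{F}(\boldsymbol{z}^1,\dots,\boldsymbol{z}^m)=\sum_{i_1,\dots,i_m=1}^{N}\mathcal{F}_{i_1\dots i_m}z^1_{i_1}\cdots z^m_{i_m}$ is its multilinear form. The symbol $\bullet$ marks a position left open for a vector entry, so that e.g. $\mathcal{F}(\bullet,\boldsymbol{z}^2,\dots,\boldsymbol{z}^m)$ is the vector in $\mathbb{C}^N$ whose $i$-th entry is $\sum_{i_2,\dots,i_m}\mathcal{F}_{i i_2\dots i_m}z^2_{i_2}\cdots z^m_{i_m}$; similarly $\binom{\bullet}{\bullet}$ marks an open position for a vector in $\mathbb{C}^{2n}$. $\boldsymbol{x}^{\mathrm{H}}$ is the conjugate transpose. With $\Pi(i_1\dots i_d)$ the set of all distinct permutations of $i_1,\dots,i_d$, a tensor $\mathcal{F}\in\mathbb{C}^{n^{2d}}$ is conjugate partial-symmetric if for all $1\le i_1\le\dots\le i_d\le n$ and $1\le i_{d+1}\le\dots\le i_{2d}\le n$: (i) $\mathcal{F}_{i_1\dots i_d i_{d+1}\dots i_{2d}} = \mathcal{F}_{j_1\dots j_d j_{d+1}\dots j_{2d}}$ for all $(j_1\dots j_d) \in \Pi (i_1\dots i_d)$ and $(j_{d+1}\dots j_{2d})\in\Pi(i_{d+1}\dots i_{2d})$; and (ii) $\mathcal{F}_{i_1\dots i_d i_{d+1}\dots i_{2d}}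 = \overline{\mathcal{F}_{i_{d+1}\dots i_{2d} i_1\dots i_d}}$. A tensor $\mathcal{F}\in\mathbb{C}^{(2n)^d}$ is conjugate super-symmetric if (i) its entries are invariant under all permutations of the indices, and (ii) $\mathcal{F}_{i_1\dots i_d} = \overline{\mathcal{F}_{j_1\dots j_d }}$ for all $1\le i_1, \dots, i_d, j_1,\dots, j_d\le 2n$ with $|i_k -j_k| = n$ for $k=1,\dots,d$. $\lambda\in\mathbb{C}$ is a C-eigenvalue of a conjugate partial-symmetric tensor $\mathcal{F}\in\mathbb{C}^{n^{2d}}$ if there exists $\boldsymbol{x}\in\mathbb{C}^n$ (a C-eigenvector) with $\boldsymbol{x}^{\mathrm{H}}\boldsymbol{x}=1$ and $$\mathcal{F}(\bullet,\underbrace{\overline{\boldsymbol{x}},\dots,\overline{\boldsymbol{x}}}_{d-1}, \underbrace{\boldsymbol{x},\dots,\boldsymbol{x}}_d)=\lambda \boldsymbol{x}.$$ $\lambda\in\mathbb{C}$ is a G-eigenvalue of a conjugate super-symmetric tensor $\mathcal{F}\in\mathbb{C}^{(2n)^d}$ if there exists $\boldsymbol{x}\in\mathbb{C}^n$ (a G-eigenvector) with $\boldsymbol{x}^{\mathrm{H}}\boldsymbol{x}=1$ and $$\mathcal{F}\bigg(\binom{\bullet}{\bullet}, \underbrace{\binom{\overline{\boldsymbol{x}}}{\boldsymbol{x}}, \dots,\binom{\overline{\boldsymbol{x}}}{\boldsymbol{x}}}_{d-1} \bigg)=\lambda \binom{\boldsymbol{x}}{\overline{\boldsymbol{x}}}.$$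 *)

theory Defs
  imports "Jordan_Normal_Form.Matrix" "HOL-Library.NList"
begin

text \<open>
  A tensor with \<open>m\<close> indices ranging over a set of size \<open>N\<close> is a function on index lists; only
  its values on \<open>nlists m {..<N}\<close>, the lists of length \<open>m\<close> with entries below \<open>N\<close>, matter.
  Indices start at 0, as for \<^typ>\<open>complex vec\<close>.
\<close>

type_synonym tensor = "nat list \<Rightarrow> complex"

definition multilinear_form :: "nat \<Rightarrow> tensor \<Rightarrow> complex vec list \<Rightarrow> complex" where
  "multilinear_form N F zs =
     (\<Sum>I\<in>nlists (length zs) {..<N}. F I * (\<Prod>k<length zs. (zs ! k) $ (I ! k)))"

text \<open>The vector \<open>F(\<bullet>, z\<^sup>2, \<dots>, z\<^sup>m)\<close>, where \<open>zs = [z\<^sup>2, \<dots>, z\<^sup>m]\<close>.\<close>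

definition open_first :: "nat \<Rightarrow> tensor \<Rightarrow> complex vec list \<Rightarrow> complex vec" where
  "open_first N F zs = vec N (\<lambda>i. multilinear_form N (\<lambda>I. F (i # I)) zs)"

text \<open>Equality of multisets says that one index list is a permutation of the other.\<close>

definition conj_partial_symmetric :: "nat \<Rightarrow> nat \<Rightarrow> tensor \<Rightarrow> bool" where
  "conj_partial_symmetric n d F \<longleftrightarrow>
     (\<forall>I \<in> nlists d {..<n}. \<forall>J \<in> nlists d {..<n}. sorted I \<longrightarrow> sorted J \<longrightarrow>
        (\<forall>I' J'. mset I' = mset I \<longrightarrow> mset J' = mset J \<longrightarrow> F (I @ J) = F (I' @ J')) \<and>
        F (I @ J) = cnj (F (J @ I)))"

definition conj_super_symmetric :: "nat \<Rightarrow> nat \<Rightarrow> tensor \<Rightarrow> bool" where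
  "conj_super_symmetric n d F \<longleftrightarrow>
     (\<forall>I \<in> nlists d {..<2 * n}. \<forall>J. mset J = mset I \<longrightarrow> F I = F J) \<and>
     (\<forall>I \<in> nlists d {..<2 * n}. \<forall>J \<in> nlists d {..<2 * n}.
        (\<forall>k<d. \<bar>int (I ! k) - int (J ! k)\<bar> = int n) \<longrightarrow> F I = cnj (F J))"

definition C_eigenvalue :: "nat \<Rightarrow> nat \<Rightarrow> tensor \<Rightarrow> complex \<Rightarrow> bool" where
  "C_eigenvalue n d F lam \<longleftrightarrow>
     (\<exists>x \<in> carrier_vec n. conjugate x \<bullet> x = 1 \<and>
        open_first n F (replicate (d - 1) (conjugate x) @ replicate d x) = lam \<cdot>\<^sub>v x)"

definition G_eigenvalue :: "nat \<Rightarrow> nat \<Rightarrow> tensor \<Rightarrow> complex \<Rightarrow> bool" where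
  "G_eigenvalue n d F lam \<longleftrightarrow>
     (\<exists>x \<in> carrier_vec n. conjugate x \<bullet> x = 1 \<and>
        open_first (2 * n) F (replicate (d - 1) (conjugate x @\<^sub>v x)) = lam \<cdot>\<^sub>v (x @\<^sub>v conjugate x))"

end

theory Submission
  imports Defs
begin

text \<open>
  Contracting the eigenvalue equation with the vector that fills its open position turns it into
  \<open>F(z, \<dots>, z') = c \<lambda>\<close> with \<open>c = x\<^sup>H x = 1\<close> for C-eigenvalues and \<open>c = 2\<close> for
  G-eigenvalues, so it suffices that these full contractions are real. In both cases complex
  conjugation permutes the terms of the sum defining the contraction: there is an involution of
  the index lists that conjugates the entries of the tensor by its symmetry, and conjugates the
  products of vector entries because the arguments come in conjugate pairs. For a conjugate
  partial-symmetric tensor the involution exchanges the two halves of the index list; for a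
  conjugate super-symmetric one it shifts every index by \<open>n\<close> modulo \<open>2 n\<close>.
\<close>

text \<open>
  As simplification rules, these two loop once membership in \<open>nlists\<close> is unfolded: their premise
  turns into their conclusion.
\<close>

declare nlistsE_length [simp del] nlistsE_set [simp del]

lemma sum_nlists_Suc:
  "(\<Sum>I\<in>nlists (Suc m) A. f I) = (\<Sum>i\<in>A. \<Sum>I\<in>nlists m A. f (i # I))"
proof -
  have "bij_betw (\<lambda>(i, I). i # I) (A \<times> nlists m A) (nlists (Suc m) A)"
    by (rule bij_betwI[where g = "\<lambda>I. (hd I, tl I)"])
       (auto simp: in_nlists_Suc_iff)
  from sum.reindex_bij_betw[OF this, of f] show ?thesis
    by (simp add: sum.cartesian_product case_prod_unfold)
qed

lemma multilinear_form_Cons: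
  "multilinear_form N F (z # zs) = z \<bullet> open_first N F zs"
proof -
  have "(\<Prod>k<Suc (length zs). ((z # zs) ! k) $ ((i # I) ! k))
      = z $ i * (\<Prod>k<length zs. (zs ! k) $ (I ! k))" for i I
    unfolding prod.lessThan_Suc_shift by simp
  then have "multilinear_form N F (z # zs) = (\<Sum>i<N. \<Sum>I\<in>nlists (length zs) {..<N}.
      z $ i * (F (i # I) * (\<Prod>k<length zs. (zs ! k) $ (I ! k))))"
    unfolding multilinear_form_def length_Cons sum_nlists_Suc by (simp only: mult.left_commute)
  also have "\<dots> = (\<Sum>i<N. z $ i * multilinear_form N (\<lambda>I. F (i # I)) zs)"
    unfolding multilinear_form_def sum_distrib_left ..
  also have "\<dots> = z \<bullet> open_first N F zs"
    by (simp add: open_first_def scalar_prod_def lessThan_atLeast0)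
  finally show ?thesis .
qed

text \<open>
  The common core of both cases: an involution of the index lists that has the same effect as
  complex conjugation on each term of the contraction.
\<close>

lemma multilinear_form_real:
  assumes mem: "\<And>I. I \<in> nlists (length zs) {..<N} \<Longrightarrow> s I \<in> nlists (length zs) {..<N}"
    and invol: "\<And>I. I \<in> nlists (length zs) {..<N} \<Longrightarrow> s (s I) = I"
    and entry: "\<And>I. I \<in> nlists (length zs) {..<N} \<Longrightarrow> F (s I) = cnj (F I)"
    and weight: "\<And>I. I \<in> nlists (length zs) {..<N} \<Longrightarrow>
      (\<Prod>k<length zs. (zs ! k) $ (s I ! k)) = cnj (\<Prod>k<length zs. (zs ! k) $ (I ! k))"
  shows "multilinear_form N F zs \<in> \<real>"
proof -
  have "bij_betw s (nlists (length zs) {..<N}) (nlists (length zs) {..<N})"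
    by (rule bij_betwI[where g = s]) (auto simp: mem invol)
  from sum.reindex_bij_betw[OF this, symmetric]
  have "multilinear_form N F zs =
      (\<Sum>I\<in>nlists (length zs) {..<N}. F (s I) * (\<Prod>k<length zs. (zs ! k) $ (s I ! k)))"
    unfolding multilinear_form_def .
  also have "\<dots> = cnj (multilinear_form N F zs)"
    unfolding multilinear_form_def cnj_sum
    by (intro sum.cong refl) (simp only: entry weight complex_cnj_mult)
  finally show ?thesis
    by (simp add: Reals_cnj_iff)
qed

text \<open>
  The definition states the conjugation symmetry for sorted halves only; permutation invariance
  extends it to arbitrary ones.
\<close>

lemma conj_partial_symmetric_swap:
  assumes F: "conj_partial_symmetric n d F"
    and I: "I \<in> nlists d {..<n}" and J: "J \<in> nlists d {..<n}"
  shows "F (J @ I) = cnj (F (I @ J))"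
proof -
  have sort_mem: "sort K \<in> nlists d {..<n}" if "K \<in> nlists d {..<n}" for K
    using that by (simp add: nlists_def)
  have sorted_eq: "F (sort K @ sort L) = F (K @ L)"
    if "K \<in> nlists d {..<n}" "L \<in> nlists d {..<n}" for K L
  proof -
    have "\<forall>K' L'. mset K' = mset (sort K) \<longrightarrow> mset L' = mset (sort L) \<longrightarrow>
        F (sort K @ sort L) = F (K' @ L')"
      using F that[THEN sort_mem] sorted_sort[of K] sorted_sort[of L]
      unfolding conj_partial_symmetric_def by blast
    then show ?thesis
      by simp
  qed
  have "F (sort J @ sort I) = cnj (F (sort I @ sort J))"
    using F sort_mem[OF I] sort_mem[OF J] sorted_sort[of I] sorted_sort[of J]
    unfolding conj_partial_symmetric_def by blast
  then show ?thesis
    by (simp add: sorted_eq I J)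
qed

lemma prod_nth_append:
  assumes "length I = d" "length J = e"
  shows "(\<Prod>k<d + e. ((replicate d y @ replicate e x) ! k) $ ((I @ J) ! k))
    = (\<Prod>k<d. y $ (I ! k)) * (\<Prod>k<e. (x $ (J ! k) :: complex))"
proof -
  have "(\<Prod>k<d + e. g k) = (\<Prod>k<d. g k) * (\<Prod>k<e. g (d + k))" for g :: "nat \<Rightarrow> complex"
    by (induction e) (simp_all add: mult.assoc)
  then show ?thesis
    using assms by (simp add: nth_append)
qed

text \<open>
  Rotating a list of length \<open>2 d\<close> by \<open>d\<close> exchanges its halves, and the two halves of the
  argument list are conjugate to each other.
\<close>

lemma conj_partial_symmetric_form_real:
  assumes F: "conj_partial_symmetric n d F" and x: "x \<in> carrier_vec n"
  shows "multilinear_form n F (replicate d (conjugate x) @ replicate d x) \<in> \<real>"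
proof (rule multilinear_form_real[where s = "rotate d"], unfold length_append length_replicate)
  fix L assume L: "L \<in> nlists (d + d) {..<n}"
  then show "rotate d L \<in> nlists (d + d) {..<n}"
    by (simp add: nlists_def)
  show "rotate d (rotate d L) = L"
    using L by (simp add: rotate_rotate nlists_def)
  obtain I J where IJ: "L = I @ J" "I \<in> nlists d {..<n}" "J \<in> nlists d {..<n}"
  proof
    show "L = take d L @ drop d L" by simp
    show "take d L \<in> nlists d {..<n}" "drop d L \<in> nlists d {..<n}"
      using L by (auto simp: nlists_def dest: in_set_takeD in_set_dropD)
  qed
  then have len: "length I = d" "length J = d"
    by (simp_all add: nlists_def)
  then have rot: "rotate d L = J @ I"
    using IJ(1) rotate_append[of I J] by simp
  show "F (rotate d L) = cnj (F L)"
    using conj_partial_symmetric_swap[OF F IJ(2,3)] rot IJ(1) by simp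
  have cnj_index: "(\<Prod>k<d. conjugate x $ (K ! k)) = cnj (\<Prod>k<d. x $ (K ! k))"
    if "K \<in> nlists d {..<n}" for K
  proof -
    have "K ! k < n" if "k < d" for k
      using nlistsE_nth_in[OF \<open>K \<in> _\<close> that] by simp
    then show ?thesis
      using x by simp
  qed
  show "(\<Prod>k<d + d. ((replicate d (conjugate x) @ replicate d x) ! k) $ (rotate d L ! k)) =
      cnj (\<Prod>k<d + d. ((replicate d (conjugate x) @ replicate d x) ! k) $ (L ! k))"
    unfolding rot unfolding IJ(1) prod_nth_append[OF len] prod_nth_append[OF len(2,1)]
    by (simp only: cnj_index IJ(2,3) complex_cnj_mult complex_cnj_cnj mult.commute)
qed

text \<open>
  The involution shifts each index by \<open>n\<close>, which exchanges the conjugate blocks of the vector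
  formed by the conjugate of \<open>x\<close> followed by \<open>x\<close>.
\<close>

lemma conj_super_symmetric_form_real:
  assumes F: "conj_super_symmetric n d F" and x: "x \<in> carrier_vec n"
  shows "multilinear_form (2 * n) F (replicate d (conjugate x @\<^sub>v x)) \<in> \<real>"
proof -
  define t where "t i = (if i < n then i + n else i - n)" for i
  show ?thesis
  proof (rule multilinear_form_real[where s = "map t"], unfold length_replicate)
    fix I assume "I \<in> nlists d {..<2 * n}"
    then have len: "length I = d" and lt: "\<And>i. i \<in> set I \<Longrightarrow> i < 2 * n"
      by (auto simp: nlists_def)
    show tI: "map t I \<in> nlists d {..<2 * n}"
      using len lt by (fastforce simp: nlists_def t_def)
    have "t (t i) = i" if "i < 2 * n" for i
      using that by (auto simp: t_def)
    then show "map t (map t I) = I"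
      using lt by (simp add: map_idI)
    have "\<forall>k<d. \<bar>int (map t I ! k) - int (I ! k)\<bar> = int n"
      using len by (auto simp: t_def)
    then show "F (map t I) = cnj (F I)"
      using F tI \<open>I \<in> _\<close> unfolding conj_super_symmetric_def by blast
    have "(conjugate x @\<^sub>v x) $ t i = cnj ((conjugate x @\<^sub>v x) $ i)" if "i < 2 * n" for i
      using that x by (auto simp: t_def)
    then show "(\<Prod>k<d. (replicate d (conjugate x @\<^sub>v x) ! k) $ (map t I ! k)) =
        cnj (\<Prod>k<d. (replicate d (conjugate x @\<^sub>v x) ! k) $ (I ! k))"
      using len lt by (simp add: cnj_prod)
  qed
qed

lemma C_eigenvalue_real:
  assumes "d \<ge> 1" and F: "conj_partial_symmetric n d F" and "C_eigenvalue n d F lam"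
  shows "lam \<in> \<real>"
proof -
  from assms(3) obtain x where x: "x \<in> carrier_vec n" and unit: "conjugate x \<bullet> x = 1"
    and eig: "open_first n F (replicate (d - 1) (conjugate x) @ replicate d x) = lam \<cdot>\<^sub>v x"
    unfolding C_eigenvalue_def by blast
  have "replicate d (conjugate x) = conjugate x # replicate (d - 1) (conjugate x)"
    using \<open>d \<ge> 1\<close> by (cases d) simp_all
  then have "multilinear_form n F (replicate d (conjugate x) @ replicate d x)
      = conjugate x \<bullet> (lam \<cdot>\<^sub>v x)"
    by (simp only: append_Cons multilinear_form_Cons eig)
  also have "\<dots> = lam"
    using x unit by simp
  finally show ?thesis
    using conj_partial_symmetric_form_real[OF F x] by simp
qed

lemma G_eigenvalue_real:
  assumes "d \<ge> 1" and F: "conj_super_symmetric n d F" and "G_eigenvalue n d F lam"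
  shows "lam \<in> \<real>"
proof -
  from assms(3) obtain x where x: "x \<in> carrier_vec n" and unit: "conjugate x \<bullet> x = 1"
    and eig: "open_first (2 * n) F (replicate (d - 1) (conjugate x @\<^sub>v x))
      = lam \<cdot>\<^sub>v (x @\<^sub>v conjugate x)"
    unfolding G_eigenvalue_def by blast
  have cx: "conjugate x \<in> carrier_vec n"
    using x by simp
  have "replicate d (conjugate x @\<^sub>v x)
      = (conjugate x @\<^sub>v x) # replicate (d - 1) (conjugate x @\<^sub>v x)"
    using \<open>d \<ge> 1\<close> by (cases d) simp_all
  then have "multilinear_form (2 * n) F (replicate d (conjugate x @\<^sub>v x))
      = (conjugate x @\<^sub>v x) \<bullet> (lam \<cdot>\<^sub>v (x @\<^sub>v conjugate x))"
    by (simp only: append_Cons multilinear_form_Cons eig)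
  also have "\<dots> = lam * ((conjugate x @\<^sub>v x) \<bullet> (x @\<^sub>v conjugate x))"
    using x by (intro scalar_prod_smult_distrib[of _ "n + n"]) auto
  also have "(conjugate x @\<^sub>v x) \<bullet> (x @\<^sub>v conjugate x) = 2"
    using scalar_prod_append[OF cx x x cx] comm_scalar_prod[OF x cx] unit by simp
  finally have "lam * 2 \<in> \<real>"
    using conj_super_symmetric_form_real[OF F x] by simp
  then have "lam * 2 / 2 \<in> \<real>"
    by (intro Reals_divide Reals_numeral)
  then show ?thesis
    by simp
qed

theorem proposition4p6:
  shows "(\<forall>(n::nat) (d::nat) (F::tensor) (lam::complex).
            d \<ge> 1 \<longrightarrow> conj_partial_symmetric n d F \<longrightarrow> C_eigenvalue n d F lam \<longrightarrow> lam \<in> \<real>) \<and>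
         (\<forall>(n::nat) (d::nat) (F::tensor) (lam::complex).
            d \<ge> 1 \<longrightarrow> conj_super_symmetric n d F \<longrightarrow> G_eigenvalue n d F lam \<longrightarrow> lam \<in> \<real>)"
  using C_eigenvalue_real G_eigenvalue_real by blast

end
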